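(* Let $0\le l\le n-2$ and let $T_{n-l,l}$ be the tadpole obtained by joining a vertex of the cycle $C_{n-l}$ to an end vertex of the path $P_l$ by an edge (for $l=0$, $T_{n,0}=C_n$). Then \[ X_{T_{n-l,l}}=\sum_{I\vDash n}\Theta_I^+(l+1)\,w_I\,e_I . \]
   Context: A composition $I=i_1\cdots i_s\vDash n$ is a sequence of positive integers with sum $n$; $e_I$ denotes the elementary symmetric function $e_{i_1}e_{i_2}\cdots e_{i_s}$. Define $w_I=i_1\prod_{j\ge2}(i_j-1)$. For $0\le a\le n$, let $\sigma_I^+(a)=\min\{i_1+\dots+i_k:0\le k\le s,\ i_1+\dots+i_k\ge a\}$ and $\Theta_I^+(a)=\sigma_I^+(a)-a$. $C_m$ is the cycle on $m$ vertices ($C_2$ being two vertices joined by an edge), $P_l$ the path on $l$ vertices. The chromatic symmetric function of a graph $G$ is $X_G=\sum_\kappa\prod_{v\in V(G)}x_{\kappa(v)}$ over proper colorings $\kappa:V(G)\to\{1,2,\dots\}$. *)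

theory Defs
  imports "HOL-Library.Multiset" "HOL-Library.FuncSet"
begin

text \<open>
  A monomial $x_{i_1} \cdots x_{i_k}$ is the multiset of its variable indices, so that
  multiplication of monomials is addition of multisets. A formal power series is the family
  of its coefficients. Only the variables $x_1, x_2, \ldots$ are used below.
\<close>

typedef 'a mpser = "UNIV :: (nat multiset \<Rightarrow> 'a) set"
  morphisms mcoeff Abs_mpser ..

lemma mcoeff_Abs [simp]: "mcoeff (Abs_mpser f) = f"
  by (simp add: Abs_mpser_inverse)

lemma mpser_eqI: "(\<And>m. mcoeff f m = mcoeff g m) \<Longrightarrow> f = g"
  by (metis ext mcoeff_inject)

lemma finite_submultisets: "finite {a. a \<subseteq># (m :: 'b multiset)}"
proof (rule finite_subset)
  show "{a. a \<subseteq># m} \<subseteq> mset ` {xs. set xs \<subseteq> set_mset m \<and> length xs \<le> size m}"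
  proof
    fix a assume a: "a \<in> {a. a \<subseteq># m}"
    obtain xs where xs: "mset xs = a" using ex_mset by blast
    have "set xs \<subseteq> set_mset m" using a xs set_mset_mono[of a m] by auto
    moreover have "length xs \<le> size m" using a xs size_mset_mono[of a m] by auto
    ultimately show "a \<in> mset ` {xs. set xs \<subseteq> set_mset m \<and> length xs \<le> size m}"
      using xs by blast
  qed
  show "finite (mset ` {xs. set xs \<subseteq> set_mset m \<and> length xs \<le> size m})"
    by (intro finite_imageI finite_lists_length_le) simp
qed

instantiation mpser :: (comm_ring_1) comm_ring_1
begin

definition zero_mpser :: "'a mpser" where
  "0 = Abs_mpser (\<lambda>m. 0)"

definition one_mpser :: "'a mpser" where
  "1 = Abs_mpser (\<lambda>m. if m = {#} then 1 else 0)"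

definition plus_mpser :: "'a mpser \<Rightarrow> 'a mpser \<Rightarrow> 'a mpser" where
  "f + g = Abs_mpser (\<lambda>m. mcoeff f m + mcoeff g m)"

definition uminus_mpser :: "'a mpser \<Rightarrow> 'a mpser" where
  "- f = Abs_mpser (\<lambda>m. - mcoeff f m)"

definition minus_mpser :: "'a mpser \<Rightarrow> 'a mpser \<Rightarrow> 'a mpser" where
  "f - g = Abs_mpser (\<lambda>m. mcoeff f m - mcoeff g m)"

definition times_mpser :: "'a mpser \<Rightarrow> 'a mpser \<Rightarrow> 'a mpser" where
  "f * g = Abs_mpser (\<lambda>m. \<Sum>a | a \<subseteq># m. mcoeff f a * mcoeff g (m - a))"

instance
proof
  fix f g h :: "'a mpser"
  show "f * g = g * f"
  proof (rule mpser_eqI)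
    fix m
    show "mcoeff (f * g) m = mcoeff (g * f) m"
      unfolding times_mpser_def mcoeff_Abs
      by (rule sum.reindex_bij_witness[of _ "\<lambda>a. m - a" "\<lambda>a. m - a"])
        (auto simp: mult.commute subset_mset.diff_diff_right)
  qed
  show "f * g * h = f * (g * h)"
  proof (rule mpser_eqI)
    fix m
    have "mcoeff (f * g * h) m
        = (\<Sum>c | c \<subseteq># m. \<Sum>a | a \<subseteq># c. mcoeff f a * mcoeff g (c - a) * mcoeff h (m - c))"
      by (simp add: times_mpser_def sum_distrib_right)
    also have "\<dots> = (\<Sum>(c, a) \<in> (SIGMA c:{c. c \<subseteq># m}. {a. a \<subseteq># c}).
        mcoeff f a * mcoeff g (c - a) * mcoeff h (m - c))"
      by (rule sum.Sigma) (auto simp: finite_submultisets)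
    also have "\<dots> = (\<Sum>(a, b) \<in> (SIGMA a:{a. a \<subseteq># m}. {b. b \<subseteq># m - a}).
        mcoeff f a * (mcoeff g b * mcoeff h (m - a - b)))"
      by (rule sum.reindex_bij_witness[of _ "\<lambda>(a, b). (a + b, a)" "\<lambda>(c, a). (a, c - a)"])
        (auto simp: mult.assoc subseteq_mset_def multiset_eq_iff le_diff_conv2 add.commute
          diff_le_mono intro: le_trans intro!: le_diff_conv2[THEN iffD1])
    also have "\<dots> = (\<Sum>a | a \<subseteq># m. \<Sum>b | b \<subseteq># m - a.
        mcoeff f a * (mcoeff g b * mcoeff h (m - a - b)))"
      by (rule sum.Sigma [symmetric]) (auto simp: finite_submultisets)
    also have "\<dots> = mcoeff (f * (g * h)) m"
      by (simp add: times_mpser_def sum_distrib_left)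
    finally show "mcoeff (f * g * h) m = mcoeff (f * (g * h)) m" .
  qed
  show "1 * f = f"
  proof (rule mpser_eqI)
    fix m
    have "mcoeff (1 * f) m = (\<Sum>a | a \<subseteq># m. if a = {#} then mcoeff f m else 0)"
      unfolding times_mpser_def one_mpser_def mcoeff_Abs by (rule sum.cong) auto
    then show "mcoeff (1 * f) m = mcoeff f m"
      by (simp add: finite_submultisets)
  qed
  show "(f + g) * h = f * h + g * h"
    by (rule mpser_eqI) (simp add: times_mpser_def plus_mpser_def distrib_right sum.distrib)
  show "(0 :: 'a mpser) \<noteq> 1"
  proof
    assume "(0 :: 'a mpser) = 1"
    then have "mcoeff (0 :: 'a mpser) {#} = mcoeff 1 {#}" by simp
    then show False by (simp add: zero_mpser_def one_mpser_def)
  qed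
qed (auto intro!: mpser_eqI
      simp: plus_mpser_def zero_mpser_def uminus_mpser_def minus_mpser_def algebra_simps)

end

text \<open>
  The formal sum of the monomials \<open>mon a\<close> over the (possibly infinite) index set \<open>A\<close>:
  the coefficient of \<open>m\<close> is the number of indices contributing \<open>m\<close>. It is meaningful if
  each monomial arises from only finitely many indices.
\<close>

definition monomial_sum :: "'i set \<Rightarrow> ('i \<Rightarrow> nat multiset) \<Rightarrow> 'a :: comm_ring_1 mpser" where
  "monomial_sum A mon = Abs_mpser (\<lambda>m. of_nat (card {a \<in> A. mon a = m}))"

definition esym :: "nat \<Rightarrow> 'a :: comm_ring_1 mpser" where
  "esym k = monomial_sum {S. finite S \<and> S \<subseteq> {1..} \<and> card S = k} mset_set"

definition esym_list :: "nat list \<Rightarrow> 'a :: comm_ring_1 mpser" where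
  "esym_list I = prod_list (map esym I)"

definition compositions :: "nat \<Rightarrow> nat list set" where
  "compositions n = {I. (\<forall>i \<in> set I. 0 < i) \<and> sum_list I = n}"

text \<open>The value at the empty composition is a convention.\<close>

fun comp_weight :: "nat list \<Rightarrow> nat" where
  "comp_weight [] = 1"
| "comp_weight (i # J) = i * prod_list (map (\<lambda>j. j - 1) J)"

definition sigma_plus :: "nat list \<Rightarrow> nat \<Rightarrow> nat" where
  "sigma_plus I a = Min {sum_list (take k I) | k. k \<le> length I \<and> a \<le> sum_list (take k I)}"

definition Theta_plus :: "nat list \<Rightarrow> nat \<Rightarrow> nat" where
  "Theta_plus I a = sigma_plus I a - a"

lemma finite_compositions: "finite (compositions n)"
proof (rule finite_subset)
  show "compositions n \<subseteq> {I. set I \<subseteq> {..n} \<and> length I \<le> n}"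
  proof
    fix I assume I: "I \<in> compositions n"
    have "length J \<le> sum_list J" if "\<forall>i \<in> set J. 0 < i" for J :: "nat list"
      using that by (induction J) (auto simp: Suc_le_eq add_strict_increasing)
    with I show "I \<in> {I. set I \<subseteq> {..n} \<and> length I \<le> n}"
      by (auto simp: compositions_def member_le_sum_list)
  qed
qed (simp add: finite_lists_length_le)

text \<open>Vertex set and set of edges \<open>{u, v}\<close>.\<close>

type_synonym 'v ugraph = "'v set \<times> 'v set set"

definition proper_colorings :: "'v ugraph \<Rightarrow> ('v \<Rightarrow> nat) set" where
  "proper_colorings G =
    {\<kappa> \<in> fst G \<rightarrow>\<^sub>E {1..}. \<forall>u v. {u, v} \<in> snd G \<longrightarrow> \<kappa> u \<noteq> \<kappa> v}"

definition chromatic_sym :: "'v ugraph \<Rightarrow> 'a :: comm_ring_1 mpser" where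
  "chromatic_sym G = monomial_sum (proper_colorings G) (\<lambda>\<kappa>. image_mset \<kappa> (mset_set (fst G)))"

lemma finite_colorings_of_monomial:
  assumes "finite (fst G)"
  shows "finite {\<kappa> \<in> proper_colorings G. image_mset \<kappa> (mset_set (fst G)) = m}"
proof (rule finite_subset)
  show "{\<kappa> \<in> proper_colorings G. image_mset \<kappa> (mset_set (fst G)) = m}
      \<subseteq> fst G \<rightarrow>\<^sub>E set_mset m"
    using assms by (auto simp: proper_colorings_def PiE_iff extensional_def)
  show "finite (fst G \<rightarrow>\<^sub>E set_mset m)"
    using assms by (intro finite_PiE) auto
qed

text \<open>For \<open>m = 2\<close> the two edges below coincide, so the cycle is a single edge.\<close>

definition cycle_graph :: "nat \<Rightarrow> nat ugraph" where
  "cycle_graph m = ({..<m}, {{i, (i + 1) mod m} | i. i < m})"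

definition path_graph :: "nat \<Rightarrow> nat ugraph" where
  "path_graph l = ({..<l}, {{i, i + 1} | i. i + 1 < l})"

text \<open>
  The cycle vertex and the path end that are joined may be chosen arbitrarily: all choices
  give isomorphic graphs. The path is the right summand, and empty for \<open>l = 0\<close>.
\<close>

definition tadpole :: "nat \<Rightarrow> nat \<Rightarrow> (nat + nat) ugraph" where
  "tadpole m l =
    (Inl ` fst (cycle_graph m) \<union> Inr ` fst (path_graph l),
     (image Inl) ` snd (cycle_graph m) \<union> (image Inr) ` snd (path_graph l)
       \<union> (if l = 0 then {} else {{Inl 0, Inr 0}}))"

end

theory Submission
  imports Defs "HOL-Computational_Algebra.Formal_Power_Series"
begin

text \<open>
  Write \<open>T m l\<close>, \<open>C m\<close>, \<open>P n\<close> for the chromatic symmetric functions of tadpoles, cycles and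
  paths. Triple deletion at the vertex of attachment gives
  \<open>T m (l + 1) + P (m + l + 1) = T (m + 1) l + C m * P (l + 1)\<close>. The right-hand side of the theorem
  satisfies the same relation, because \<open>\<Theta>\<^sup>+ I (l + 1) - \<Theta>\<^sup>+ I l\<close> is \<open>-1\<close> plus the part of \<open>I\<close> that
  starts at the partial sum \<open>l\<close>, if there is one, and splitting \<open>I\<close> there factors the weight.
  Since \<open>T 2 (n - 2) = P n\<close>, and \<open>C m\<close> with \<open>m < n\<close> is known by induction on \<open>n\<close>, the
  theorem follows by descending from \<open>l = n - 2\<close>, without a separate computation for cycles.
  The expansion of \<open>P n\<close> comes from the generating function \<open>E / (E - z E')\<close>.
\<close>

section \<open>Formal sums of monomials\<close>

text \<open>\<open>card\<close> sends an infinite fibre to 0, so \<open>monomial_sum\<close> is a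
  genuine formal sum only under this condition.\<close>

definition finite_fibres :: "'i set \<Rightarrow> ('i \<Rightarrow> nat multiset) \<Rightarrow> bool" where
  "finite_fibres A mon \<longleftrightarrow> (\<forall>m. finite {a \<in> A. mon a = m})"

lemma finite_fibres_subset:
  assumes "finite_fibres B f" "A \<subseteq> B"
  shows "finite_fibres A f"
  unfolding finite_fibres_def
proof
  fix m
  have "{a \<in> A. f a = m} \<subseteq> {a \<in> B. f a = m}" using assms(2) by blast
  then show "finite {a \<in> A. f a = m}"
    using assms(1) unfolding finite_fibres_def by (blast intro: finite_subset)
qed

lemma mcoeff_monomial_sum:
  "mcoeff (monomial_sum A f :: 'a :: comm_ring_1 mpser) m = of_nat (card {a \<in> A. f a = m})"
  by (simp add: monomial_sum_def)

lemma mcoeff_0: "mcoeff (0 :: 'a :: comm_ring_1 mpser) m = 0"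
  by (simp add: zero_mpser_def)

lemma mcoeff_add: "mcoeff (f + g :: 'a :: comm_ring_1 mpser) m = mcoeff f m + mcoeff g m"
  by (simp add: plus_mpser_def)

lemma mcoeff_of_nat_mult:
  "mcoeff (of_nat k * f :: 'a :: comm_ring_1 mpser) m = of_nat k * mcoeff f m"
  by (induction k) (simp_all add: mcoeff_0 mcoeff_add distrib_right)

lemma monomial_sum_cong_bij:
  assumes "bij_betw h A B" "\<And>a. a \<in> A \<Longrightarrow> g (h a) = f a"
  shows "monomial_sum A f = (monomial_sum B g :: 'a :: comm_ring_1 mpser)"
proof (rule mpser_eqI)
  fix m
  have "bij_betw h {a \<in> A. f a = m} {b \<in> B. g b = m}"
    using assms unfolding bij_betw_def inj_on_def by auto
  then show "mcoeff (monomial_sum A f :: 'a mpser) m = mcoeff (monomial_sum B g) m"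
    by (simp add: mcoeff_monomial_sum bij_betw_same_card)
qed

lemma monomial_sum_Un:
  assumes "finite_fibres (A \<union> B) f" "A \<inter> B = {}"
  shows "monomial_sum (A \<union> B) f
    = (monomial_sum A f + monomial_sum B f :: 'a :: comm_ring_1 mpser)"
proof (rule mpser_eqI)
  fix m
  have fin: "finite {a \<in> A. f a = m}" "finite {a \<in> B. f a = m}"
    using finite_fibres_subset[OF assms(1)] unfolding finite_fibres_def by blast+
  have "{a \<in> A \<union> B. f a = m} = {a \<in> A. f a = m} \<union> {a \<in> B. f a = m}" by blast
  then have "card {a \<in> A \<union> B. f a = m} = card {a \<in> A. f a = m} + card {a \<in> B. f a = m}"
    using fin assms(2) by (auto intro: card_Un_disjoint)
  then show "mcoeff (monomial_sum (A \<union> B) f :: 'a mpser) m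
      = mcoeff (monomial_sum A f + monomial_sum B f) m"
    by (simp add: mcoeff_monomial_sum mcoeff_add)
qed

text \<open>Once the first factor \<open>u\<close> of \<open>m\<close> is chosen, the second is
  forced to be \<open>m - u\<close>; this turns counting pairs into the convolution that defines the
  product.\<close>

lemma product_fibre:
  "{x \<in> A \<times> B. (case x of (a, b) \<Rightarrow> f a + g b) = m}
    = (\<Union>u \<in> {u. u \<subseteq># m}. {a \<in> A. f a = u} \<times> {b \<in> B. g b = m - u})"
  by auto

lemma finite_fibres_times:
  assumes "finite_fibres A f" "finite_fibres B g"
  shows "finite_fibres (A \<times> B) (\<lambda>(a, b). f a + g b)"
  using assms unfolding finite_fibres_def product_fibre
  by (intro allI finite_UN_I finite_cartesian_product finite_submultisets) blast+

lemma monomial_sum_times: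
  assumes "finite_fibres A f" "finite_fibres B g"
  shows "monomial_sum A f * monomial_sum B g
    = (monomial_sum (A \<times> B) (\<lambda>(a, b). f a + g b) :: 'a :: comm_ring_1 mpser)"
proof (rule mpser_eqI)
  fix m
  have "card {x \<in> A \<times> B. (case x of (a, b) \<Rightarrow> f a + g b) = m}
      = (\<Sum>u | u \<subseteq># m. card ({a \<in> A. f a = u} \<times> {b \<in> B. g b = m - u}))"
    unfolding product_fibre
    by (rule card_UN_disjoint)
      (use assms in \<open>auto simp: finite_submultisets finite_fibres_def\<close>)
  then show "mcoeff (monomial_sum A f * monomial_sum B g :: 'a mpser) m
      = mcoeff (monomial_sum (A \<times> B) (\<lambda>(a, b). f a + g b)) m"
    by (simp add: times_mpser_def mcoeff_monomial_sum card_cartesian_product)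
qed

section \<open>Power sums and Newton-type identities\<close>

definition psum :: "nat \<Rightarrow> 'a :: comm_ring_1 mpser" where
  "psum k = monomial_sum {1..} (\<lambda>c. replicate_mset k c)"

text \<open>A positive power of a variable determines the variable. For \<open>k = 0\<close> every
  index would contribute the empty monomial, hence \<open>0 < k\<close> here and in the product
  rules below.\<close>

lemma finite_fibres_replicate: "0 < k \<Longrightarrow> finite_fibres {1..} (\<lambda>c. replicate_mset k c)"
  unfolding finite_fibres_def
proof
  fix m assume "0 < k"
  then have "{c \<in> {1..}. replicate_mset k c = m} \<subseteq> set_mset m" by auto
  then show "finite {c \<in> {1..}. replicate_mset k c = m}" by (rule finite_subset) simp
qed

definition subsets_of_card :: "nat \<Rightarrow> nat set set" where
  "subsets_of_card k = {S. finite S \<and> S \<subseteq> {1..} \<and> card S = k}"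

lemma esym_eq: "esym k = monomial_sum (subsets_of_card k) mset_set"
  by (simp add: esym_def subsets_of_card_def)

lemma finite_fibres_subsets: "finite_fibres (subsets_of_card k) mset_set"
  unfolding finite_fibres_def
proof
  fix m
  have "{S \<in> subsets_of_card k. mset_set S = m} \<subseteq> {set_mset m}"
    by (auto simp: subsets_of_card_def)
  then show "finite {S \<in> subsets_of_card k. mset_set S = m}" by (rule finite_subset) simp
qed

text \<open>These encode the proper colourings of the path on \<open>n\<close> vertices, so that
  \<open>path_sym n\<close> is its chromatic symmetric function; the letter 0 is barred because the
  variables are numbered from 1.\<close>

definition path_words :: "nat \<Rightarrow> nat list set" where
  "path_words n = {xs. length xs = n \<and> 0 \<notin> set xs \<and> distinct_adj xs}"

definition path_sym :: "nat \<Rightarrow> 'a :: comm_ring_1 mpser" where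
  "path_sym n = monomial_sum (path_words n) mset"

lemma finite_fibres_mset: "finite_fibres A mset"
  unfolding finite_fibres_def
proof
  fix m :: "nat multiset"
  have "{xs \<in> A. mset xs = m} \<subseteq> {xs. set xs \<subseteq> set_mset m \<and> length xs = size m}" by auto
  then show "finite {xs \<in> A. mset xs = m}"
    by (rule finite_subset) (simp add: finite_lists_length_eq)
qed

text \<open>By \<open>step\<close> each product is a sum of two \<open>d\<close> terms, the second
  of which cancels against the next product under the alternating sign; \<open>base\<close> ends the
  chain. Splitting off \<open>i = 0\<close> shifts \<open>k\<close> to \<open>Suc k\<close>, so the
  induction generalises \<open>k\<close>.\<close>

lemma alternating_telescope:
  fixes p a :: "nat \<Rightarrow> 'a :: comm_ring_1"
  assumes base: "\<And>k. 0 < k \<Longrightarrow> p k * a 0 = d k 0"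
    and step: "\<And>k r. 0 < k \<Longrightarrow> p k * a (Suc r) = d k (Suc r) + d (Suc k) r"
    and "0 < k"
  shows "(\<Sum>i\<le>r. (- 1) ^ i * p (k + i) * a (r - i)) = d k r"
  using \<open>0 < k\<close>
proof (induction r arbitrary: k)
  case 0
  then show ?case using base by simp
next
  case (Suc r)
  have "(\<Sum>i\<le>Suc r. (- 1) ^ i * p (k + i) * a (Suc r - i))
      = p k * a (Suc r) - (\<Sum>i\<le>r. (- 1) ^ i * p (Suc k + i) * a (r - i))"
    unfolding sum.atMost_Suc_shift by (simp add: sum_negf)
  also have "\<dots> = d k (Suc r)" using Suc.IH[of "Suc k"] Suc.prems step by simp
  finally show ?case .
qed

text \<open>This is the series \<open>z E' / E\<close>, where \<open>E\<close> is the generating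
  function of the \<open>esym k\<close>.\<close>

definition signed_psum_fps :: "'a :: comm_ring_1 mpser fps" where
  "signed_psum_fps = Abs_fps (\<lambda>n. if n = 0 then 0 else (- 1) ^ (n - 1) * psum n)"

text \<open>The coefficient at \<open>Suc r\<close> is the telescoping sum for \<open>k = 1\<close>,
  of which only \<open>d 1 r\<close> survives.\<close>

lemma signed_psum_fps_mult_nth:
  fixes a :: "nat \<Rightarrow> 'a :: comm_ring_1 mpser"
  assumes "\<And>k. 0 < k \<Longrightarrow> psum k * a 0 = d k 0"
    and "\<And>k r. 0 < k \<Longrightarrow> psum k * a (Suc r) = d k (Suc r) + d (Suc k) r"
  shows "fps_nth (signed_psum_fps * Abs_fps a) n = (if n = 0 then 0 else d 1 (n - 1))"
proof (cases n)
  case 0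
  then show ?thesis by (simp add: signed_psum_fps_def fps_mult_nth)
next
  case (Suc r)
  have "fps_nth (signed_psum_fps * Abs_fps a) n
      = (\<Sum>i\<le>Suc r. (if i = 0 then 0 else (- 1) ^ (i - 1) * psum i) * a (Suc r - i))"
    by (simp add: signed_psum_fps_def fps_mult_nth Suc atLeast0AtMost)
  also have "\<dots> = (\<Sum>i\<le>r. (- 1) ^ i * psum (1 + i) * a (r - i))"
    unfolding sum.atMost_Suc_shift by simp
  also have "\<dots> = d 1 r" by (rule alternating_telescope[where p = psum and a = a and d = d, OF assms]) auto
  finally show ?thesis using Suc by simp
qed

text \<open>
  A product with \<open>psum k\<close> is split according to whether the repeated colour \<open>c\<close> lies in the
  subset (starts the word). If it does, it is moved into the power, so that the alternating
  sums of these products telescope.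
\<close>

definition point_subset :: "nat \<Rightarrow> nat \<Rightarrow> 'a :: comm_ring_1 mpser" where
  "point_subset k r = monomial_sum {(c, S) \<in> {1..} \<times> subsets_of_card r. c \<notin> S}
    (\<lambda>(c, S). replicate_mset k c + mset_set S)"

definition point_word :: "nat \<Rightarrow> nat \<Rightarrow> 'a :: comm_ring_1 mpser" where
  "point_word k r = monomial_sum {(c, w) \<in> {1..} \<times> path_words r. w = [] \<or> hd w \<noteq> c}
    (\<lambda>(c, w). replicate_mset k c + mset w)"

lemma psum_esym_0:
  assumes "0 < k"
  shows "psum k * esym 0 = point_subset k 0"
proof -
  have "{(c, S) \<in> {1..} \<times> subsets_of_card 0. c \<notin> S} = {1..} \<times> subsets_of_card 0"
    by (auto simp: subsets_of_card_def)
  then show ?thesis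
    unfolding psum_def esym_eq point_subset_def
      monomial_sum_times[OF finite_fibres_replicate[OF assms] finite_fibres_subsets] by simp
qed

lemma psum_esym_Suc:
  assumes "0 < k"
  shows "psum k * esym (Suc r) = point_subset k (Suc r) + point_subset (Suc k) r"
proof -
  define f where "f = (\<lambda>(c :: nat, S). replicate_mset k c + mset_set S)"
  define A where "A = {(c, S) \<in> {1..} \<times> subsets_of_card (Suc r). c \<notin> S}"
  define B where "B = {(c, S) \<in> {1..} \<times> subsets_of_card (Suc r). c \<in> S}"
  have AB: "{1..} \<times> subsets_of_card (Suc r) = A \<union> B" by (auto simp: A_def B_def)
  have ff: "finite_fibres (A \<union> B) f"
    unfolding AB[symmetric] f_def
    by (intro finite_fibres_times finite_fibres_replicate finite_fibres_subsets assms)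
  have "psum k * esym (Suc r) = monomial_sum (A \<union> B) f"
    unfolding psum_def esym_eq AB[symmetric] f_def
    by (intro monomial_sum_times finite_fibres_replicate finite_fibres_subsets assms)
  also have "\<dots> = monomial_sum A f + monomial_sum B f"
    by (rule monomial_sum_Un[OF ff]) (auto simp: A_def B_def)
  also have "monomial_sum A f = point_subset k (Suc r)"
    by (simp add: point_subset_def A_def f_def)
  also have "monomial_sum B f = point_subset (Suc k) r"
    unfolding point_subset_def
  proof (rule monomial_sum_cong_bij[symmetric])
    show "bij_betw (\<lambda>(c, S). (c, insert c S)) {(c, S) \<in> {1..} \<times> subsets_of_card r. c \<notin> S} B"
      by (rule bij_betw_byWitness[where f' = "\<lambda>(c, S). (c, S - {c})"])
        (auto simp: B_def subsets_of_card_def)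
  qed (auto simp: f_def subsets_of_card_def)
  finally show ?thesis .
qed

lemma psum_path_sym_0:
  assumes "0 < k"
  shows "psum k * path_sym 0 = point_word k 0"
proof -
  have "{(c, w) \<in> {1..} \<times> path_words 0. w = [] \<or> hd w \<noteq> c} = {1..} \<times> path_words 0"
    by (auto simp: path_words_def)
  then show ?thesis
    unfolding psum_def path_sym_def point_word_def
      monomial_sum_times[OF finite_fibres_replicate[OF assms] finite_fibres_mset] by simp
qed

lemma psum_path_sym_Suc:
  assumes "0 < k"
  shows "psum k * path_sym (Suc r) = point_word k (Suc r) + point_word (Suc k) r"
proof -
  define f where "f = (\<lambda>(c :: nat, w). replicate_mset k c + mset w)"
  define A where "A = {(c, w) \<in> {1..} \<times> path_words (Suc r). w = [] \<or> hd w \<noteq> c}"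
  define B where "B = {(c, w) \<in> {1..} \<times> path_words (Suc r). hd w = c}"
  have AB: "{1..} \<times> path_words (Suc r) = A \<union> B"
    by (auto simp: A_def B_def path_words_def)
  have ff: "finite_fibres (A \<union> B) f"
    unfolding AB[symmetric] f_def
    by (intro finite_fibres_times finite_fibres_replicate finite_fibres_mset assms)
  have "psum k * path_sym (Suc r) = monomial_sum (A \<union> B) f"
    unfolding psum_def path_sym_def AB[symmetric] f_def
    by (intro monomial_sum_times finite_fibres_replicate finite_fibres_mset assms)
  also have "\<dots> = monomial_sum A f + monomial_sum B f"
    by (rule monomial_sum_Un[OF ff]) (auto simp: A_def B_def path_words_def)
  also have "monomial_sum A f = point_word k (Suc r)"
    by (simp add: point_word_def A_def f_def)
  also have "monomial_sum B f = point_word (Suc k) r"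
    unfolding point_word_def
  proof (rule monomial_sum_cong_bij[symmetric])
    show "bij_betw (\<lambda>(c, w). (c, c # w))
        {(c, w) \<in> {1..} \<times> path_words r. w = [] \<or> hd w \<noteq> c} B"
      by (rule bij_betw_byWitness[where f' = "\<lambda>(c, w). (c, tl w)"])
        (auto simp: B_def path_words_def distinct_adj_Cons length_Suc_conv)
  qed (auto simp: f_def)
  finally show ?thesis .
qed

text \<open>With exponent 1 the separate colour is just one more letter in front, different from the
  letter after it.\<close>

lemma point_word_1: "point_word 1 r = path_sym (Suc r)"
  unfolding point_word_def path_sym_def
proof (rule monomial_sum_cong_bij)
  show "bij_betw (\<lambda>(c, w). c # w)
      {(c, w) \<in> {1..} \<times> path_words r. w = [] \<or> hd w \<noteq> c} (path_words (Suc r))"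
    by (rule bij_betw_byWitness[where f' = "\<lambda>w. (hd w, tl w)"])
      (auto simp: path_words_def distinct_adj_Cons length_Suc_conv)
qed auto

text \<open>Each set of size \<open>r + 1\<close> arises from \<open>r + 1\<close> choices of its
  distinguished element \<open>c\<close>, which the monomial forgets.\<close>

lemma point_subset_1:
  "(point_subset 1 r :: 'a :: comm_ring_1 mpser) = of_nat (Suc r) * esym (Suc r)"
proof (rule mpser_eqI)
  fix m
  define B where "B = {(c, S). S \<in> subsets_of_card (Suc r) \<and> c \<in> S}"
  have "(point_subset 1 r :: 'a mpser) = monomial_sum B (\<lambda>(c, S). mset_set S)"
    unfolding point_subset_def
  proof (rule monomial_sum_cong_bij)
    show "bij_betw (\<lambda>(c, S). (c, insert c S)) {(c, S) \<in> {1..} \<times> subsets_of_card r. c \<notin> S} B"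
      by (rule bij_betw_byWitness[where f' = "\<lambda>(c, S). (c, S - {c})"])
        (auto simp: B_def subsets_of_card_def)
  qed (auto simp: subsets_of_card_def)
  moreover have "card {x \<in> B. (case x of (c, S) \<Rightarrow> mset_set S) = m}
      = Suc r * card {S \<in> subsets_of_card (Suc r). mset_set S = m}"
  proof -
    let ?F = "{S \<in> subsets_of_card (Suc r). mset_set S = m}"
    have "bij_betw prod.swap {x \<in> B. (case x of (c, S) \<Rightarrow> mset_set S) = m} (SIGMA S:?F. S)"
      by (rule bij_betw_byWitness[where f' = prod.swap]) (auto simp: B_def)
    then have "card {x \<in> B. (case x of (c, S) \<Rightarrow> mset_set S) = m} = card (SIGMA S:?F. S)"
      by (rule bij_betw_same_card)
    also have "\<dots> = (\<Sum>S\<in>?F. card S)"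
      using finite_fibres_subsets
      by (intro card_SigmaI) (auto simp: finite_fibres_def subsets_of_card_def)
    also have "\<dots> = (\<Sum>S\<in>?F. Suc r)" by (rule sum.cong) (auto simp: subsets_of_card_def)
    finally show ?thesis by simp
  qed
  ultimately show "mcoeff (point_subset 1 r :: 'a mpser) m
      = mcoeff (of_nat (Suc r) * esym (Suc r)) m"
    by (simp only: mcoeff_monomial_sum mcoeff_of_nat_mult esym_eq of_nat_mult)
qed

section \<open>Generating functions and the recurrence for paths\<close>

lemma esym_0: "esym 0 = (1 :: 'a :: comm_ring_1 mpser)"
proof (rule mpser_eqI)
  fix m :: "nat multiset"
  have "{S \<in> subsets_of_card 0. mset_set S = m} = (if m = {#} then {{}} else {})"
    by (auto simp: subsets_of_card_def)
  then show "mcoeff (esym 0 :: 'a mpser) m = mcoeff 1 m"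
    by (simp add: esym_eq mcoeff_monomial_sum one_mpser_def)
qed

lemma path_sym_0: "path_sym 0 = (1 :: 'a :: comm_ring_1 mpser)"
proof (rule mpser_eqI)
  fix m :: "nat multiset"
  have "{xs \<in> path_words 0. mset xs = m} = (if m = {#} then {[]} else {})"
    by (auto simp: path_words_def)
  then show "mcoeff (path_sym 0 :: 'a mpser) m = mcoeff 1 m"
    by (simp add: path_sym_def mcoeff_monomial_sum one_mpser_def)
qed

text \<open>
  With \<open>E\<close>, \<open>P\<close>, \<open>Q\<close> the generating functions of elementary, path and signed power sum
  functions: \<open>P = 1 + Q P\<close> and \<open>Q E = z E'\<close>, hence \<open>E P = E + z E' P\<close>.
\<close>

lemma esym_path_convolution:
  "(\<Sum>k\<le>n. esym k * path_sym (n - k))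
    = (esym n + (\<Sum>k\<le>n. of_nat k * esym k * path_sym (n - k)) :: 'a :: comm_ring_1 mpser)"
proof -
  let ?E = "Abs_fps esym :: 'a mpser fps" and ?P = "Abs_fps path_sym :: 'a mpser fps"
  let ?Q = "signed_psum_fps :: 'a mpser fps"
  let ?D = "Abs_fps (\<lambda>n. of_nat n * esym n) :: 'a mpser fps"
  have P: "?P = 1 + ?Q * ?P"
  proof (rule fps_ext)
    fix n
    show "fps_nth ?P n = fps_nth (1 + ?Q * ?P) n"
      using signed_psum_fps_mult_nth[where 'a = 'a and a = path_sym and d = point_word and n = n,
          OF psum_path_sym_0 psum_path_sym_Suc] point_word_1[of "n - 1", where 'a = 'a]
      by (cases n) (simp_all add: path_sym_0)
  qed
  have D: "?Q * ?E = ?D"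
  proof (rule fps_ext)
    fix n
    show "fps_nth (?Q * ?E) n = fps_nth ?D n"
      using signed_psum_fps_mult_nth[where 'a = 'a and a = esym and d = point_subset and n = n,
          OF psum_esym_0 psum_esym_Suc] point_subset_1[of "n - 1", where 'a = 'a]
      by (cases n) simp_all
  qed
  have "?E * ?P = ?E + (?Q * ?E) * ?P"
    by (subst P) (simp add: algebra_simps)
  then have "fps_nth (?E * ?P) n = fps_nth (?E + ?D * ?P) n" by (simp add: D)
  then show ?thesis by (simp add: fps_mult_nth atLeast0AtMost)
qed

text \<open>In the convolution identity the term \<open>k = 0\<close> is \<open>path_sym n\<close>
  on the left, as \<open>esym 0 = 1\<close>, and vanishes on the right. Moving the other left terms
  across lowers each coefficient \<open>k\<close> to \<open>k - 1\<close>.\<close>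

lemma path_sym_recurrence:
  "path_sym n = (esym n + (\<Sum>k=1..n. of_nat (k - 1) * esym k * path_sym (n - k))
    :: 'a :: comm_ring_1 mpser)"
proof -
  have split: "(\<Sum>k\<le>n. f k) = f 0 + (\<Sum>k=1..n. f k)" for f :: "nat \<Rightarrow> 'a mpser"
    by (simp add: atMost_atLeast0 sum.atLeast_Suc_atMost)
  have "path_sym n + (\<Sum>k=1..n. esym k * path_sym (n - k))
      = (esym n + (\<Sum>k=1..n. of_nat k * esym k * path_sym (n - k)) :: 'a mpser)"
    using esym_path_convolution[of n, where 'a = 'a] unfolding split by (simp add: esym_0)
  moreover have "(\<Sum>k=1..n. of_nat k * esym k * path_sym (n - k))
      = ((\<Sum>k=1..n. of_nat (k - 1) * esym k * path_sym (n - k))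
        + (\<Sum>k=1..n. esym k * path_sym (n - k)) :: 'a mpser)"
    unfolding sum.distrib[symmetric]
    by (rule sum.cong) (auto simp: of_nat_diff algebra_simps)
  ultimately show ?thesis by (simp add: algebra_simps)
qed

section \<open>Sums over compositions\<close>

text \<open>The statistic in front of the weight is left free: the constant 1 yields paths,
  \<open>Theta_plus\<close> tadpoles, and \<open>part_starting_at\<close> the correction between
  consecutive tadpoles.\<close>

definition weighted_sum :: "(nat list \<Rightarrow> nat) \<Rightarrow> nat \<Rightarrow> 'a :: comm_ring_1 mpser" where
  "weighted_sum f n = (\<Sum>I \<in> compositions n. of_nat (f I * comp_weight I) * esym_list I)"

lemma compositions_0: "compositions 0 = {[]}"
proof -
  have "I = []" if "\<forall>i \<in> set I. 0 < i" "sum_list I = 0" for I :: "nat list"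
    using that by (cases I) auto
  then show ?thesis by (auto simp: compositions_def)
qed

lemma Nil_in_compositions_iff: "[] \<in> compositions n \<longleftrightarrow> n = 0"
  by (auto simp: compositions_def)

lemma compositions_by_last_part:
  assumes "0 < n"
  shows "compositions n = (\<lambda>(k, J). J @ [k]) ` (SIGMA k:{1..n}. compositions (n - k))"
proof (intro set_eqI iffI)
  fix I assume I: "I \<in> compositions n"
  with assms have "I \<noteq> []" by (auto simp: Nil_in_compositions_iff)
  then obtain J k where "I = J @ [k]" by (metis rev_exhaust)
  with I show "I \<in> (\<lambda>(k, J). J @ [k]) ` (SIGMA k:{1..n}. compositions (n - k))"
    by (intro image_eqI[of _ _ "(k, J)"]) (auto simp: compositions_def)
qed (auto simp: compositions_def)

text \<open>An appended part counts \<open>k - 1\<close>, unless it is also the first part and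
  counts \<open>k\<close>; since \<open>comp_weight [] = 1\<close>, the excess is then exactly
  1.\<close>

lemma comp_weight_snoc:
  "0 < k \<Longrightarrow> comp_weight (J @ [k]) = comp_weight J * (k - 1) + (if J = [] then 1 else 0)"
  by (cases J) auto

lemma comp_weight_append:
  "J \<noteq> [] \<Longrightarrow> comp_weight (J @ K) = comp_weight J * prod_list (map (\<lambda>j. j - 1) K)"
  by (cases J) auto

lemma esym_list_append: "esym_list (J @ K) = esym_list J * esym_list K"
  by (simp add: esym_list_def)

text \<open>Grouping by the last part reproduces \<open>path_sym_recurrence\<close>. For positive
  \<open>n\<close> the extra \<open>esym n\<close> comes from the one-part composition, which has
  weight \<open>n\<close> instead of \<open>n - 1\<close>.\<close>

lemma weighted_sum_1_recurrence:
  "weighted_sum (\<lambda>_. 1) n = (esym n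
    + (\<Sum>k=1..n. of_nat (k - 1) * esym k * weighted_sum (\<lambda>_. 1) (n - k)) :: 'a :: comm_ring_1 mpser)"
proof (cases "n = 0")
  case True
  then show ?thesis by (simp add: weighted_sum_def compositions_0 esym_0 esym_list_def)
next
  case False
  then have "0 < n" by simp
  have inj: "inj_on (\<lambda>(k, J). J @ [k]) (SIGMA k:{1..n}. compositions (n - k))"
    by (auto simp: inj_on_def)
  let ?g = "\<lambda>I. of_nat (comp_weight I) * esym_list I :: 'a mpser"
  have snoc: "?g (J @ [k]) = of_nat (k - 1) * esym k * ?g J + (if J = [] then esym k else 0)"
    if "0 < k" for J k
    using that
    by (simp add: comp_weight_snoc esym_list_append algebra_simps) (simp add: esym_list_def)
  have "weighted_sum (\<lambda>_. 1) n = (\<Sum>I\<in>compositions n. ?g I)" by (simp add: weighted_sum_def)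
  also have "\<dots> = (\<Sum>(k, J) \<in> (SIGMA k:{1..n}. compositions (n - k)). ?g (J @ [k]))"
    unfolding compositions_by_last_part[OF \<open>0 < n\<close>] sum.reindex[OF inj]
    by (simp add: case_prod_unfold)
  also have "\<dots> = (\<Sum>k=1..n. \<Sum>J\<in>compositions (n - k). ?g (J @ [k]))"
    by (rule sum.Sigma[symmetric]) (auto simp: finite_compositions)
  also have "\<dots> = (\<Sum>k=1..n. of_nat (k - 1) * esym k * weighted_sum (\<lambda>_. 1) (n - k)
      + (if k = n then esym n else 0))"
  proof (rule sum.cong)
    fix k assume k: "k \<in> {1..n}"
    then have "(\<Sum>J\<in>compositions (n - k). ?g (J @ [k]))
        = (\<Sum>J\<in>compositions (n - k). of_nat (k - 1) * esym k * ?g J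
            + (if J = [] then esym k else 0))"
      by (intro sum.cong refl snoc) auto
    also have "\<dots> = of_nat (k - 1) * esym k * weighted_sum (\<lambda>_. 1) (n - k)
        + (if k = n then esym n else 0)"
      using k by (auto simp: sum.distrib sum_distrib_left weighted_sum_def finite_compositions
          Nil_in_compositions_iff)
    finally show "(\<Sum>J\<in>compositions (n - k). ?g (J @ [k]))
        = of_nat (k - 1) * esym k * weighted_sum (\<lambda>_. 1) (n - k)
          + (if k = n then esym n else 0)" .
  qed simp
  also have "\<dots> = (\<Sum>k=1..n. of_nat (k - 1) * esym k * weighted_sum (\<lambda>_. 1) (n - k)) + esym n"
    using False by (simp add: sum.distrib)
  finally show ?thesis by (simp add: add.commute)
qed

lemma path_sym_eq_weighted_sum:
  "path_sym n = (weighted_sum (\<lambda>_. 1) n :: 'a :: comm_ring_1 mpser)"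
proof (induction n rule: less_induct)
  case (less n)
  show ?case
    by (subst path_sym_recurrence, subst weighted_sum_1_recurrence)
      (use less in \<open>auto intro!: sum.cong\<close>)
qed

section \<open>The statistic \<Theta> and cutting a composition at a partial sum\<close>

lemma sigma_plus_0: "sigma_plus I 0 = 0"
proof -
  let ?S = "{sum_list (take k I) |k. k \<le> length I \<and> 0 \<le> sum_list (take k I)}"
  have "finite ?S" by simp
  moreover have "0 \<in> ?S" by (auto intro: exI[of _ 0])
  ultimately have "Min ?S \<le> 0" by (rule Min_le)
  then show ?thesis by (simp add: sigma_plus_def)
qed

text \<open>For positive \<open>a\<close> the empty prefix is not admissible, so every admissible
  prefix contains \<open>i\<close>. Truncated subtraction covers \<open>a \<le> i\<close>, and the
  upper bound on \<open>a\<close> keeps the set under \<open>Min\<close> nonempty.\<close>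

lemma sigma_plus_Cons:
  assumes "0 < a" "a \<le> i + sum_list I"
  shows "sigma_plus (i # I) a = i + sigma_plus I (a - i)"
proof -
  let ?T = "{sum_list (take k I) |k. k \<le> length I \<and> a - i \<le> sum_list (take k I)}"
  have "{sum_list (take k (i # I)) |k. k \<le> length (i # I) \<and> a \<le> sum_list (take k (i # I))}
      = (+) i ` ?T" (is "?S = _")
  proof (intro set_eqI iffI)
    fix x assume "x \<in> ?S"
    then obtain k where k: "x = sum_list (take k (i # I))" "k \<le> length (i # I)" "a \<le> x" by auto
    with assms(1) obtain j where "k = Suc j" by (cases k) auto
    with k show "x \<in> (+) i ` ?T" by (auto intro!: image_eqI exI[of _ j])
  next
    fix x assume "x \<in> (+) i ` ?T"
    then obtain j where "x = i + sum_list (take j I)" "j \<le> length I" "a - i \<le> sum_list (take j I)"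
      by auto
    then show "x \<in> ?S" by (auto intro!: exI[of _ "Suc j"])
  qed
  moreover have "finite ?T" by simp
  moreover have "?T \<noteq> {}" using assms(2) by (auto intro!: exI[of _ "length I"])
  ultimately show ?thesis
    unfolding sigma_plus_def by (simp add: mono_Min_commute[of "(+) i"] mono_def)
qed

lemma Theta_plus_0: "Theta_plus I 0 = 0"
  by (simp add: Theta_plus_def sigma_plus_0)

lemma Theta_plus_Cons:
  assumes "0 < a" "a \<le> i + sum_list I"
  shows "Theta_plus (i # I) a = (if a \<le> i then i - a else Theta_plus I (a - i))"
  using sigma_plus_Cons[OF assms] by (auto simp: Theta_plus_def sigma_plus_0)

fun part_starting_at :: "nat list \<Rightarrow> nat \<Rightarrow> nat" where
  "part_starting_at [] a = 0"
| "part_starting_at (i # I) a =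
    (if a = 0 then i else if a < i then 0 else part_starting_at I (a - i))"

text \<open>Advancing \<open>a\<close> by one shortens the distance to the next partial sum by one,
  except when \<open>a\<close> is itself a partial sum: then the distance jumps from 0 to the next
  part minus 1. The 1 stands on the left to avoid truncated subtraction.\<close>

lemma Theta_plus_Suc:
  assumes "\<forall>i \<in> set I. 0 < i" "a < sum_list I"
  shows "Theta_plus I (Suc a) + 1 = Theta_plus I a + part_starting_at I a"
  using assms
proof (induction I arbitrary: a)
  case (Cons i I)
  show ?case
  proof (cases "a < i")
    case True
    with Cons.prems show ?thesis
      by (cases "a = 0") (auto simp: Theta_plus_Cons Theta_plus_0)
  next
    case False
    with Cons have "Theta_plus I (Suc (a - i)) + 1
        = Theta_plus I (a - i) + part_starting_at I (a - i)"
      by (intro Cons.IH) auto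
    with False Cons.prems show ?thesis
      by (auto simp: Theta_plus_Cons Theta_plus_0 Suc_diff_le)
  qed
qed simp

lemma part_starting_at_append:
  assumes "\<forall>i \<in> set J. 0 < i"
  shows "part_starting_at (J @ K) (sum_list J) = part_starting_at K 0"
  using assms by (induction J) auto

lemma part_starting_at_nonzeroD:
  "part_starting_at I a \<noteq> 0 \<Longrightarrow> \<exists>J K. I = J @ K \<and> sum_list J = a"
proof (induction I arbitrary: a)
  case (Cons i I)
  show ?case
  proof (cases "a = 0")
    case True
    then show ?thesis by (intro exI[of _ "[]"] exI[of _ "i # I"]) simp
  next
    case False
    with Cons.prems have "\<not> a < i" "part_starting_at I (a - i) \<noteq> 0" by (auto split: if_splits)
    with Cons.IH obtain J K where "I = J @ K" "sum_list J = a - i" by blast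
    with \<open>\<not> a < i\<close> show ?thesis by (intro exI[of _ "i # J"] exI[of _ K]) simp
  qed
qed simp

text \<open>Partial sums of positive parts increase strictly, so the value of a partial sum fixes
  where the list is cut.\<close>

lemma append_eq_append_sum_list:
  fixes J J' :: "nat list"
  assumes "J @ K = J' @ K'" "sum_list J = sum_list J'"
    "\<forall>i \<in> set (J @ K). 0 < i"
  shows "J = J' \<and> K = K'"
  using assms
proof (induction J arbitrary: J')
  case Nil
  then show ?case by (cases J') auto
next
  case (Cons i J)
  then show ?case by (cases J') auto
qed

text \<open>Only compositions with partial sum \<open>l\<close> contribute; each is uniquely
  \<open>J @ K\<close>, and its summand factors along this cut.\<close>

lemma weighted_sum_part_starting_at:
  assumes "0 < l" "l < n"
  shows "weighted_sum (\<lambda>I. part_starting_at I l) n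
    = (weighted_sum (\<lambda>_. 1) l * weighted_sum (\<lambda>I. Theta_plus I 1) (n - l) :: 'a :: comm_ring_1 mpser)"
proof -
  let ?A = "compositions l \<times> compositions (n - l)"
  let ?g = "\<lambda>I. of_nat (part_starting_at I l * comp_weight I) * esym_list I :: 'a mpser"
  have inj: "inj_on (\<lambda>(J, K). J @ K) ?A"
  proof (rule inj_onI, clarify)
    fix J K J' K' assume eq: "J @ K = J' @ K'" and JK: "J \<in> compositions l"
      "K \<in> compositions (n - l)" "J' \<in> compositions l"
    have "\<forall>i \<in> set (J @ K). 0 < i" "sum_list J = sum_list J'"
      using JK by (auto simp: compositions_def)
    with eq show "J = J' \<and> K = K'" by (blast dest: append_eq_append_sum_list)
  qed
  have "weighted_sum (\<lambda>I. part_starting_at I l) n = (\<Sum>I\<in>compositions n. ?g I)"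
    by (simp add: weighted_sum_def)
  also have "\<dots> = (\<Sum>I\<in>(\<lambda>(J, K). J @ K) ` ?A. ?g I)"
  proof (rule sum.mono_neutral_right)
    show "(\<lambda>(J, K). J @ K) ` ?A \<subseteq> compositions n"
      using assms by (auto simp: compositions_def)
    show "\<forall>I \<in> compositions n - (\<lambda>(J, K). J @ K) ` ?A. ?g I = 0"
    proof
      fix I assume I: "I \<in> compositions n - (\<lambda>(J, K). J @ K) ` ?A"
      have "part_starting_at I l = 0"
      proof (rule ccontr)
        assume "part_starting_at I l \<noteq> 0"
        then obtain J K where "I = J @ K" "sum_list J = l"
          using part_starting_at_nonzeroD by blast
        with I have "(J, K) \<in> ?A" by (auto simp: compositions_def)
        with I \<open>I = J @ K\<close> show False by force
      qed
      then show "?g I = 0" by simp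
    qed
  qed (rule finite_compositions)
  also have "\<dots> = (\<Sum>(J, K)\<in>?A. ?g (J @ K))"
    unfolding sum.reindex[OF inj] by (simp add: case_prod_unfold)
  also have "\<dots> = (\<Sum>(J, K)\<in>?A. (of_nat (comp_weight J) * esym_list J)
      * (of_nat (Theta_plus K 1 * comp_weight K) * esym_list K))"
  proof (rule sum.cong, simp, clarify)
    fix J K assume J: "J \<in> compositions l" and K: "K \<in> compositions (n - l)"
    have "J \<noteq> []" "K \<noteq> []" using J K assms by (auto simp: Nil_in_compositions_iff)
    then obtain k K' where k: "K = k # K'" by (cases K) auto
    have "part_starting_at (J @ K) l = k"
      using J part_starting_at_append[of J K] k by (auto simp: compositions_def)
    moreover have "Theta_plus K 1 = k - 1" using k K by (auto simp: Theta_plus_Cons compositions_def)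
    \<comment> \<open>The two factors attached to \<open>k\<close> trade roles: the
      \<open>k - 1\<close> from the weight of \<open>J @ K\<close> becomes
      \<open>Theta_plus K 1\<close>, and the statistic \<open>k\<close> becomes the leading factor
      of \<open>comp_weight K\<close>.\<close>
    ultimately have "part_starting_at (J @ K) l * comp_weight (J @ K)
        = comp_weight J * (Theta_plus K 1 * comp_weight K)"
      using \<open>J \<noteq> []\<close> by (simp add: comp_weight_append k)
    then show "?g (J @ K) = (of_nat (comp_weight J) * esym_list J)
      * (of_nat (Theta_plus K 1 * comp_weight K) * esym_list K)"
      by (simp only: esym_list_append of_nat_mult mult_ac)
  qed
  also have "\<dots> = weighted_sum (\<lambda>_. 1) l * weighted_sum (\<lambda>I. Theta_plus I 1) (n - l)"
    by (simp add: weighted_sum_def sum_product sum.cartesian_product)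
  finally show ?thesis .
qed

text \<open>This is \<open>Theta_plus_Suc\<close> summed against the weights: the constant 1 gives
  the path and the starting part gives the product. The shape mirrors
  \<open>tadpole_sym_triple_deletion\<close>.\<close>

lemma weighted_sum_Theta_plus_Suc:
  assumes "0 < l" "l < n"
  shows "weighted_sum (\<lambda>I. Theta_plus I (Suc l)) n + path_sym n
    = (weighted_sum (\<lambda>I. Theta_plus I l) n
      + weighted_sum (\<lambda>I. Theta_plus I 1) (n - l) * path_sym l :: 'a :: comm_ring_1 mpser)"
proof -
  have "weighted_sum (\<lambda>I. Theta_plus I (Suc l)) n + weighted_sum (\<lambda>_. 1) n
      = (weighted_sum (\<lambda>I. Theta_plus I (Suc l) + 1) n :: 'a mpser)"
    by (simp add: weighted_sum_def sum.distrib[symmetric] algebra_simps)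
  also have "\<dots> = weighted_sum (\<lambda>I. Theta_plus I l + part_starting_at I l) n"
    unfolding weighted_sum_def using assms
    by (intro sum.cong refl, subst Theta_plus_Suc) (auto simp: compositions_def)
  also have "\<dots> = weighted_sum (\<lambda>I. Theta_plus I l) n + weighted_sum (\<lambda>I. part_starting_at I l) n"
    by (simp add: weighted_sum_def sum.distrib[symmetric] algebra_simps)
  finally show ?thesis
    using assms by (simp add: weighted_sum_part_starting_at path_sym_eq_weighted_sum mult.commute)
qed

text \<open>As \<open>2 \<le> k\<close>, the position one before the end lies beyond
  \<open>sum_list J\<close>, so the next partial sum is the total.\<close>

lemma Theta_plus_snoc_penultimate:
  assumes "\<forall>i \<in> set (J @ [k]). 0 < i" "2 \<le> k"
  shows "Theta_plus (J @ [k]) (sum_list J + k - 1) = 1"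
  using assms
proof (induction J)
  case Nil
  then show ?case using Theta_plus_Cons[of "k - 1" k "[]"] by simp
next
  case (Cons i J)
  let ?a = "sum_list J + k - 1"
  have "sum_list (i # J) + k - 1 = i + ?a" "0 < ?a" using Cons.prems by auto
  moreover have "Theta_plus (i # J @ [k]) (i + ?a) = Theta_plus (J @ [k]) ?a"
    using Theta_plus_Cons[of "i + ?a" i "J @ [k]"] \<open>0 < ?a\<close> by simp
  ultimately show ?case using Cons by simp
qed

text \<open>Compositions whose last part is 1 have weight 0, and on the others \<open>\<Theta>\<^sup>+\<close> is 1 here.\<close>

lemma weighted_sum_Theta_plus_penultimate:
  assumes "2 \<le> n"
  shows "weighted_sum (\<lambda>I. Theta_plus I (n - 1)) n = path_sym n"
proof -
  have "Theta_plus I (n - 1) * comp_weight I = 1 * comp_weight I" if I: "I \<in> compositions n" for I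
  proof -
    have "I \<noteq> []" using I assms by (auto simp: Nil_in_compositions_iff)
    then obtain J k where Jk: "I = J @ [k]" by (metis rev_exhaust)
    show ?thesis
    proof (cases "2 \<le> k")
      case True
      then show ?thesis
        using Theta_plus_snoc_penultimate[of J k] I Jk by (auto simp: compositions_def)
    next
      case False
      \<comment> \<open>Since \<open>2 \<le> n\<close>, a last part 1 is not the first part, so it
        contributes the factor \<open>1 - 1 = 0\<close>.\<close>
      then have "k = 1" "J \<noteq> []" using I Jk assms by (auto simp: compositions_def)
      then show ?thesis by (simp add: Jk comp_weight_append)
    qed
  qed
  then show ?thesis
    unfolding path_sym_eq_weighted_sum weighted_sum_def by (intro sum.cong refl) (simp only:)
qed

section \<open>Tadpoles\<close>

text \<open>
  A colouring of the tadpole is read off as a word that runs once around the cycle, ending in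
  the vertex of attachment, and then along the path.
\<close>

definition tadpole_words :: "nat \<Rightarrow> nat \<Rightarrow> nat list set" where
  "tadpole_words m l = {zs \<in> path_words (m + l). zs ! 0 \<noteq> zs ! (m - 1)}"

definition tadpole_sym :: "nat \<Rightarrow> nat \<Rightarrow> 'a :: comm_ring_1 mpser" where
  "tadpole_sym m l = monomial_sum (tadpole_words m l) mset"

text \<open>For \<open>m = 2\<close> the closing condition compares two adjacent letters, which
  already differ in a path word.\<close>

lemma tadpole_sym_2: "tadpole_sym 2 l = path_sym (l + 2)"
proof -
  have "tadpole_words 2 l = path_words (l + 2)"
    by (auto simp: tadpole_words_def path_words_def distinct_adj_conv_nth)
  then show ?thesis by (simp add: tadpole_sym_def path_sym_def)
qed

text \<open>
  Both \<open>tadpole_sym m 0 * path_sym (Suc l) - tadpole_sym m (Suc l)\<close> and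
  \<open>path_sym (m + Suc l) - tadpole_sym (Suc m) l\<close> count the words below whose letters at positions
  \<open>0\<close> and \<open>m\<close> agree.
\<close>

lemma tadpole_sym_triple_deletion:
  assumes "2 \<le> m"
  shows "tadpole_sym m (Suc l) + path_sym (m + Suc l)
    = (tadpole_sym (Suc m) l + tadpole_sym m 0 * path_sym (Suc l) :: 'a :: comm_ring_1 mpser)"
proof -
  let ?n = "m + Suc l"
  define R where "R = {zs \<in> path_words ?n. zs ! 0 = zs ! m}"
  \<comment> \<open>The closing condition for a cycle of length \<open>Suc m\<close> compares
    positions 0 and \<open>m\<close>, so \<open>R\<close> is exactly its failure.\<close>
  have eq: "path_words ?n = tadpole_words (Suc m) l \<union> R"
    by (auto simp: tadpole_words_def R_def)
  have path: "path_sym ?n = (tadpole_sym (Suc m) l + monomial_sum R mset :: 'a mpser)"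
    unfolding path_sym_def tadpole_sym_def eq
    by (rule monomial_sum_Un[OF finite_fibres_mset]) (auto simp: tadpole_words_def R_def)
  define f where "f = (\<lambda>(xs, ys). mset xs + mset ys :: nat multiset)"
  let ?X = "tadpole_words m 0 \<times> path_words (Suc l)"
  define A where "A = {(xs, ys) \<in> ?X. last xs \<noteq> hd ys}"
  define B where "B = {(xs, ys) \<in> ?X. last xs = hd ys}"
  have AB: "?X = A \<union> B" by (auto simp: A_def B_def)
  have ff: "finite_fibres (A \<union> B) f"
    unfolding AB[symmetric] f_def by (intro finite_fibres_times finite_fibres_mset)
  have "tadpole_sym m 0 * path_sym (Suc l) = (monomial_sum (A \<union> B) f :: 'a mpser)"
    unfolding tadpole_sym_def path_sym_def AB[symmetric] f_def
    by (intro monomial_sum_times finite_fibres_mset)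
  also have "\<dots> = monomial_sum A f + monomial_sum B f"
    by (rule monomial_sum_Un[OF ff]) (auto simp: A_def B_def)
  \<comment> \<open>Concatenation adds one adjacency, between \<open>last xs\<close> and
    \<open>hd ys\<close>: the edge joining cycle and path.\<close>
  also have "monomial_sum A f = tadpole_sym m (Suc l)"
    unfolding tadpole_sym_def
  proof (rule monomial_sum_cong_bij)
    have iff: "xs @ ys \<in> tadpole_words m (Suc l) \<longleftrightarrow> (xs, ys) \<in> A"
      if "length xs = m" "length ys = Suc l" for xs ys
    proof -
      have "xs \<noteq> []" "ys \<noteq> []" using that assms by auto
      moreover have "(xs @ ys) ! 0 = xs ! 0" "(xs @ ys) ! (m - 1) = xs ! (m - 1)"
        using that assms by (simp_all add: nth_append)
      ultimately show ?thesis
        using that by (auto simp: A_def tadpole_words_def path_words_def distinct_adj_append_iff)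
    qed
    show "bij_betw (\<lambda>(xs, ys). xs @ ys) A (tadpole_words m (Suc l))"
    proof (rule bij_betw_byWitness[where f' = "\<lambda>zs. (take m zs, drop m zs)"])
      show "(\<lambda>(xs, ys). xs @ ys) ` A \<subseteq> tadpole_words m (Suc l)"
      proof clarify
        fix xs ys assume "(xs, ys) \<in> A"
        then show "xs @ ys \<in> tadpole_words m (Suc l)"
          by (subst iff) (auto simp: A_def tadpole_words_def path_words_def)
      qed
      show "(\<lambda>zs. (take m zs, drop m zs)) ` tadpole_words m (Suc l) \<subseteq> A"
      proof clarify
        fix zs assume "zs \<in> tadpole_words m (Suc l)"
        then show "(take m zs, drop m zs) \<in> A"
          by (subst iff[symmetric]) (auto simp: tadpole_words_def path_words_def)
      qed
    qed (auto simp: A_def tadpole_words_def path_words_def)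
  qed (auto simp: f_def)
  \<comment> \<open>Here \<open>last xs = hd ys\<close>, so plain concatenation is not proper.
    Reversing \<open>xs\<close> moves this common colour to position 0, where it equals the letter
    at position \<open>m\<close>; the new neighbours \<open>hd xs\<close> and \<open>hd ys\<close>
    differ because \<open>xs\<close> closes up properly to a cycle.\<close>
  also have "monomial_sum B f = monomial_sum R mset"
  proof (rule monomial_sum_cong_bij)
    have iff: "rev xs @ ys \<in> R \<longleftrightarrow> (xs, ys) \<in> B"
      if "length xs = m" "length ys = Suc l" for xs ys
    proof -
      have "xs \<noteq> []" "ys \<noteq> []" using that assms by auto
      then have ends: "(rev xs @ ys) ! 0 = last xs" "(rev xs @ ys) ! m = hd ys"
        "xs ! 0 = hd xs" "xs ! (m - 1) = last xs"
        using that assms by (simp_all add: nth_append rev_nth hd_conv_nth last_conv_nth)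
      have "rev xs @ ys \<in> R \<longleftrightarrow> 0 \<notin> set xs \<and> 0 \<notin> set ys \<and> distinct_adj xs \<and> distinct_adj ys
          \<and> hd xs \<noteq> hd ys \<and> last xs = hd ys"
        using that \<open>xs \<noteq> []\<close> \<open>ys \<noteq> []\<close>
        by (simp add: R_def path_words_def ends distinct_adj_append_iff last_rev)
      moreover have "(xs, ys) \<in> B \<longleftrightarrow> 0 \<notin> set xs \<and> 0 \<notin> set ys \<and> distinct_adj xs \<and> distinct_adj ys
          \<and> hd xs \<noteq> last xs \<and> last xs = hd ys"
        using that by (simp add: B_def tadpole_words_def path_words_def ends[simplified]) blast
      ultimately show ?thesis by metis
    qed
    show "bij_betw (\<lambda>(xs, ys). rev xs @ ys) B R"
    proof (rule bij_betw_byWitness[where f' = "\<lambda>zs. (rev (take m zs), drop m zs)"])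
      show "(\<lambda>(xs, ys). rev xs @ ys) ` B \<subseteq> R"
      proof clarify
        fix xs ys assume "(xs, ys) \<in> B"
        then show "rev xs @ ys \<in> R"
          by (subst iff) (auto simp: B_def tadpole_words_def path_words_def)
      qed
      show "(\<lambda>zs. (rev (take m zs), drop m zs)) ` R \<subseteq> B"
      proof clarify
        fix zs assume "zs \<in> R"
        then show "(rev (take m zs), drop m zs) \<in> B"
          by (subst iff[symmetric]) (auto simp: R_def path_words_def)
      qed
    qed (auto simp: B_def R_def tadpole_words_def path_words_def)
  qed (auto simp: f_def)
  finally show ?thesis using path by (simp add: algebra_simps)
qed

section \<open>Colourings of the tadpole graph as words\<close>

lemma bij_betw_colouring_words:
  assumes "distinct vs"
  shows "bij_betw (\<lambda>\<kappa>. map \<kappa> vs) (set vs \<rightarrow>\<^sub>E C) {xs. length xs = length vs \<and> set xs \<subseteq> C}"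
  unfolding bij_betw_def
proof (intro conjI inj_onI set_eqI iffI)
  fix \<kappa> \<kappa>' assume "\<kappa> \<in> set vs \<rightarrow>\<^sub>E C" "\<kappa>' \<in> set vs \<rightarrow>\<^sub>E C" "map \<kappa> vs = map \<kappa>' vs"
  then show "\<kappa> = \<kappa>'" by (intro PiE_ext[of \<kappa> "set vs" "\<lambda>_. C"]) auto
next
  fix xs assume "xs \<in> {xs. length xs = length vs \<and> set xs \<subseteq> C}"
  then have len: "length xs = length vs" and sub: "set xs \<subseteq> C" by auto
  define \<kappa> where "\<kappa> = restrict (\<lambda>v. the (map_of (zip vs xs) v)) (set vs)"
  have map: "map \<kappa> vs = xs"
    by (rule nth_equalityI) (auto simp: \<kappa>_def len map_of_zip_nth assms)
  have "\<kappa> ` set vs \<subseteq> C" using sub by (metis list.set_map map)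
  then have "\<kappa> \<in> set vs \<rightarrow>\<^sub>E C" by (auto simp: \<kappa>_def PiE_iff)
  with map show "xs \<in> (\<lambda>\<kappa>. map \<kappa> vs) ` (set vs \<rightarrow>\<^sub>E C)" by blast
qed (auto simp: PiE_iff)

text \<open>Edges are unordered, but inequality is symmetric, so one orientation of each edge
  suffices.\<close>

lemma proper_on_edge_family:
  "(\<forall>u v. {u, v} \<in> {{f i, g i} |i. Q i} \<longrightarrow> \<kappa> u \<noteq> \<kappa> v) \<longleftrightarrow> (\<forall>i. Q i \<longrightarrow> \<kappa> (f i) \<noteq> \<kappa> (g i))"
  by (auto simp: doubleton_eq_iff)

lemma proper_on_tadpole:
  "(\<forall>u v. {u, v} \<in> snd (tadpole m l) \<longrightarrow> \<kappa> u \<noteq> \<kappa> v) \<longleftrightarrow>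
    (\<forall>i. i < m \<longrightarrow> \<kappa> (Inl i) \<noteq> \<kappa> (Inl ((i + 1) mod m)))
    \<and> (\<forall>i. i + 1 < l \<longrightarrow> \<kappa> (Inr i) \<noteq> \<kappa> (Inr (i + 1))) \<and> (l \<noteq> 0 \<longrightarrow> \<kappa> (Inl 0) \<noteq> \<kappa> (Inr 0))"
proof -
  have image: "(`) h ` {{f i, g i} |i. Q i} = {{h (f i), h (g i)} |i. Q i}"
    for h :: "nat \<Rightarrow> nat + nat" and f g :: "nat \<Rightarrow> nat" and Q
    by (simp only: setcompr_eq_image image_image image_insert image_empty)
  \<comment> \<open>The joining edge is written as a family over a dummy index, so that
    \<open>proper_on_edge_family\<close> applies to all three groups of edges.\<close>
  have edge: "(if l = 0 then {} else {{Inl 0, Inr 0}})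
      = {{Inl 0 :: nat + nat, Inr 0} |i :: nat. l \<noteq> 0}"
    by simp
  show ?thesis
    unfolding tadpole_def cycle_graph_def path_graph_def snd_conv image edge
    by (simp only: Un_iff imp_disjL all_conj_distrib proper_on_edge_family) simp
qed

text \<open>Reduction modulo \<open>m\<close> acts only at \<open>i = m - 1\<close>, where it yields
  the closing edge.\<close>

lemma cyclically_distinct_iff:
  fixes m :: nat
  assumes "2 \<le> m"
  shows "(\<forall>i. i < m \<longrightarrow> f i \<noteq> f ((i + 1) mod m)) \<longleftrightarrow>
    (\<forall>i. i + 1 < m \<longrightarrow> f i \<noteq> f (i + 1)) \<and> f (m - 1) \<noteq> f 0" (is "?L \<longleftrightarrow> ?R")
proof
  assume L: ?L
  show ?R
  proof (intro conjI allI impI)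
    fix i assume "i + 1 < m"
    then have "i < m" "(i + 1) mod m = i + 1" by auto
    with L show "f i \<noteq> f (i + 1)" by metis
  next
    show "f (m - 1) \<noteq> f 0" using L[rule_format, of "m - 1"] assms by simp
  qed
next
  assume R: ?R
  show ?L
  proof (intro allI impI)
    fix i assume "i < m"
    then have "i + 1 < m \<or> i = m - 1" by auto
    with R assms show "f i \<noteq> f ((i + 1) mod m)" by auto
  qed
qed

lemma chromatic_sym_tadpole:
  assumes "2 \<le> m"
  shows "chromatic_sym (tadpole m l) = (tadpole_sym m l :: 'a :: comm_ring_1 mpser)"
proof -
  \<comment> \<open>The cycle is listed backwards so that the attachment vertex \<open>Inl 0\<close>
    comes last, at position \<open>m - 1\<close>, directly before \<open>Inr 0\<close>.\<close>
  define vs :: "(nat + nat) list" where "vs = map Inl (rev [0..<m]) @ map Inr [0..<l]"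
  have dist: "distinct vs" by (auto simp: vs_def distinct_map)
  have set_vs: "set vs = fst (tadpole m l)"
    by (auto simp: vs_def tadpole_def cycle_graph_def path_graph_def)
  have len: "length vs = m + l" by (simp add: vs_def)
  have adj: "distinct_adj (map f [0..<k]) \<longleftrightarrow> (\<forall>i. i + 1 < k \<longrightarrow> f i \<noteq> f (i + 1))"
    for f :: "nat \<Rightarrow> nat" and k
    by (auto simp: distinct_adj_conv_nth less_diff_conv)
  have proper: "distinct_adj (map \<kappa> vs) \<and> map \<kappa> vs ! 0 \<noteq> map \<kappa> vs ! (m - 1) \<longleftrightarrow>
      (\<forall>u v. {u, v} \<in> snd (tadpole m l) \<longrightarrow> \<kappa> u \<noteq> \<kappa> v)" for \<kappa> :: "nat + nat \<Rightarrow> nat"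
  proof -
    have "map \<kappa> vs = rev (map (\<lambda>i. \<kappa> (Inl i)) [0..<m]) @ map (\<lambda>i. \<kappa> (Inr i)) [0..<l]"
      by (simp add: vs_def rev_map)
    moreover have "map \<kappa> vs ! 0 = \<kappa> (Inl (m - 1))" "map \<kappa> vs ! (m - 1) = \<kappa> (Inl 0)"
      using assms by (simp_all add: vs_def nth_append rev_nth)
    moreover have "hd (map (\<lambda>i. \<kappa> (Inl i)) [0..<m]) = \<kappa> (Inl 0)"
      using assms by (simp add: hd_map)
    moreover have "hd (map (\<lambda>i. \<kappa> (Inr i)) [0..<l]) = \<kappa> (Inr 0)" if "l \<noteq> 0"
      using that by (simp add: hd_map)
    ultimately show ?thesis
      using assms
      unfolding proper_on_tadpole cyclically_distinct_iff[OF assms, of "\<lambda>i. \<kappa> (Inl i)"]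
      by (auto simp: distinct_adj_append_iff adj last_rev)
  qed
  have "bij_betw (\<lambda>\<kappa>. map \<kappa> vs)
      {\<kappa> \<in> set vs \<rightarrow>\<^sub>E {1 :: nat..}. \<forall>u v. {u, v} \<in> snd (tadpole m l) \<longrightarrow> \<kappa> u \<noteq> \<kappa> v}
      {xs \<in> {xs. length xs = length vs \<and> set xs \<subseteq> {1..}}.
        distinct_adj xs \<and> xs ! 0 \<noteq> xs ! (m - 1)}"
    by (rule bij_betw_Collect[OF bij_betw_colouring_words[OF dist]]) (rule proper)
  moreover have "{xs \<in> {xs. length xs = length vs \<and> set xs \<subseteq> {1..}}.
        distinct_adj xs \<and> xs ! 0 \<noteq> xs ! (m - 1)} = tadpole_words m l"
    by (auto simp: tadpole_words_def path_words_def len subset_iff Suc_le_eq intro!: Nat.gr0I)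
  ultimately have "bij_betw (\<lambda>\<kappa>. map \<kappa> vs) (proper_colorings (tadpole m l)) (tadpole_words m l)"
    by (simp add: proper_colorings_def set_vs)
  then show ?thesis
    unfolding chromatic_sym_def tadpole_sym_def
    by (rule monomial_sum_cong_bij)
      (simp add: set_vs[symmetric] mset_set_set[OF dist])
qed

lemma tadpole_sym_eq_weighted_sum:
  assumes "l + 2 \<le> n"
  shows "tadpole_sym (n - l) l
    = (weighted_sum (\<lambda>I. Theta_plus I (l + 1)) n :: 'a :: comm_ring_1 mpser)"
  using assms
proof (induction n arbitrary: l rule: less_induct)
  case (less n)
  show ?case
    using less.prems
  \<comment> \<open>The inner induction lowers \<open>l\<close> from \<open>n - 2\<close>, where the
    cycle is a single edge and the tadpole is a path.\<close>
  proof (induction "n - 2 - l" arbitrary: l)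
    case 0
    then have "l = n - 2" "2 \<le> n" by auto
    then show ?case
      using weighted_sum_Theta_plus_penultimate[of n, where 'a = 'a] tadpole_sym_2[of l, where 'a = 'a]
      by (simp add: Suc_diff_Suc numeral_2_eq_2)
  next
    case (Suc d)
    have IH: "tadpole_sym (n - Suc l) (Suc l)
        = (weighted_sum (\<lambda>I. Theta_plus I (Suc l + 1)) n :: 'a mpser)"
      using Suc by (intro Suc.hyps) auto
    \<comment> \<open>The outer induction supplies the smaller cycle, as the tadpole on
      \<open>n - Suc l\<close> vertices with empty path.\<close>
    have cycle: "tadpole_sym (n - Suc l) 0
        = (weighted_sum (\<lambda>I. Theta_plus I 1) (n - Suc l) :: 'a mpser)"
      using less.IH[of "n - Suc l" 0] Suc by simp
    \<comment> \<open>Since \<open>n - 2 - l\<close> is positive here, \<open>n - Suc l\<close> is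
      at least 2, as triple deletion demands.\<close>
    have "tadpole_sym (n - Suc l) (Suc l) + path_sym n
        = (tadpole_sym (n - l) l + tadpole_sym (n - Suc l) 0 * path_sym (Suc l) :: 'a mpser)"
      using tadpole_sym_triple_deletion[of "n - Suc l" l, where 'a = 'a] Suc
      by (simp add: Suc_diff_Suc)
    moreover have "weighted_sum (\<lambda>I. Theta_plus I (Suc (Suc l))) n + path_sym n
        = (weighted_sum (\<lambda>I. Theta_plus I (Suc l)) n
          + weighted_sum (\<lambda>I. Theta_plus I 1) (n - Suc l) * path_sym (Suc l) :: 'a mpser)"
      using Suc by (intro weighted_sum_Theta_plus_Suc) auto
    ultimately show ?case using IH cycle by simp
  qed
qed

theorem theorem3p3:
  fixes n l :: nat
  assumes "l + 2 \<le> n"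
  shows "(chromatic_sym (tadpole (n - l) l) :: int mpser) =
    (\<Sum>I \<in> compositions n. of_nat (Theta_plus I (l + 1) * comp_weight I) * esym_list I)"
proof -
  have "2 \<le> n - l" using assms by simp
  then show ?thesis
    by (simp only: chromatic_sym_tadpole tadpole_sym_eq_weighted_sum[OF assms] weighted_sum_def)
qed

end
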